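(* Let $n=1$, $s\in(0,1)$, $p>1$, and suppose $sp<1$. Then $$\chi_{(0,+\infty)}\in\widetilde{\mathrm{DG}}{}^{s,p}((-1,1);0,H,0)$$ for some constant $H\ge1$. Furthermore, $$\chi_{(0,+\infty)}\notin\mathrm{DG}^{s,p}_-((-1,1);d,H,\lambda)$$ for every $d,\lambda\ge0$ and $H\ge1$. Here $\chi_{(0,+\infty)}:\mathbb{R}\to\mathbb{R}$ is the characteristic function of the half-line $(0,+\infty)$.
   Context: Notation. $B_R(x_0)$ is the open ball of radius $R$ centered at $x_0$ in $\mathbb{R}^n$ (here $n=1$); $|E|$ is Lebesgue measure; $v_+=\max\{v,0\}$, $v_-=\max\{-v,0\}$. For an open set $U$, $[u]_{W^{s,p}(U)}^p=\int_U\int_U\frac{|u(x)-u(y)|^p}{|x-y|^{n+sp}}\,dx\,dy$, and $W^{s,p}(U)$ is the space of $u\in L^p(U)$ with $[u]_{W^{s,p}(U)}<\infty$. $L^{p-1}_s(\mathbb{R}^n)$ is the set of measurable $u:\mathbb{R}^n\to\mathbb{R}$ with $\int_{\mathbb{R}^n}\frac{|u(x)|^{p-1}}{(1+|x|)^{n+sp}}\,dx<\infty$. For such $u$, $$\overline{\mathrm{Tail}}_{s,p}(u;x_0,R)=\left(\int_{\mathbb{R}^n\setminus B_R(x_0)}\frac{|u(x)|^{p-1}}{|x-x_0|^{n+sp}}\,dx\right)^{\frac1{p-1}}.$$ For $k\in\mathbb{R}$, $A^+(k,x_0,R)=\{u>k\}\cap B_R(x_0)$ and $A^-(k,x_0,R)=\{u<k\}\cap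 B_R(x_0)$. Let $\Omega\subset\mathbb{R}^n$ be bounded and open, $d,\lambda\ge0$, $H\ge1$, and let $u\in L^{p-1}_s(\mathbb{R}^n)$ with $u|_\Omega\in W^{s,p}(\Omega)$. For a choice of sign $\pm$ and for $x_0\in\Omega$, $0<r<R<\mathrm{dist}(x_0,\partial\Omega)$, $k\in\mathbb{R}$, set $$\mathcal{R}_\pm:=H\Big\{R^\lambda d^p|A^\pm(k,x_0,R)|+\frac{R^{(1-s)p}}{(R-r)^p}\|(u-k)_\pm\|_{L^p(B_R(x_0))}^p+\frac{R^{n+sp}}{(R-r)^{n+sp}}\|(u-k)_\pm\|_{L^1(B_R(x_0))}\,\overline{\mathrm{Tail}}_{s,p}((u-k)_\pm;x_0,r)^{p-1}\Big\}.$$ Weak fractional De Giorgi class: $u\in\widetilde{\mathrm{DG}}{}^{s,p}_\pm(\Omega;d,H,\lambda)$ if $[(u-k)_\pm]_{W^{s,p}(B_r(x_0))}^p\le\mathcal{R}_\pm$ for every $x_0\in\Omega$, $0<r<R<\mathrm{dist}(x_0,\partial\Omega)$, and $k\in\mathbb{R}$; and $\widetilde{\mathrm{DG}}{}^{s,p}(\Omega;d,H,\lambda)=\widetilde{\mathrm{DG}}{}^{s,p}_+(\Omega;d,H,\lambda)\cap\widetilde{\mathrm{DG}}{}^{s,p}_-(\Omega;d,H,\lambda)$. (Strong) fractional De Giorgi class: $u\in\mathrm{DG}^{s,p}_-(\Omega;d,H,\lambda)$ if $$[(u-k)_-]_{W^{s,p}(B_r(x_0))}^p+\int_{B_r(x_0)}(u(x)-k)_-\left\{\int_{\mathbb{R}^n}\frac{(u(y)-k)_+^{p-1}}{|x-y|^{n+sp}}\,dy\right\}dx\le\mathcal{R}_-$$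 for every $x_0\in\Omega$, $0<r<R<\mathrm{dist}(x_0,\partial\Omega)$, and $k\in\mathbb{R}$. *)

theory Defs
  imports "HOL-Analysis.Analysis"
begin

text \<open>
  Every integral below has a nonnegative integrand and is taken as an \<open>ennreal\<close>-valued
  \<open>nn_integral\<close> with respect to Lebesgue measure, so a divergent integral has the value
  \<open>\<infinity>\<close>. Kernels such as \<open>1 / |x - y|\<^sup>n\<^sup>+\<^sup>s\<^sup>p\<close> take the value 0 on the null set \<open>x = y\<close>.
  The parameters are meant for \<open>0 < s < 1\<close> and \<open>p > 1\<close>.
\<close>

text \<open>Real powers of extended nonnegative reals; only used for exponents \<open>a > 0\<close>.\<close>

definition epowr :: "ennreal \<Rightarrow> real \<Rightarrow> ennreal" where
  "epowr x a = (if x = \<infinity> then \<infinity> else ennreal (enn2real x powr a))"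

definition Lnorm :: "real \<Rightarrow> 'a::euclidean_space set \<Rightarrow> ('a \<Rightarrow> real) \<Rightarrow> ennreal" where
  "Lnorm q U u = epowr (\<integral>\<^sup>+x\<in>U. ennreal (\<bar>u x\<bar> powr q) \<partial>lebesgue) (1 / q)"

text \<open>The \<open>p\<close>-th power of the Gagliardo seminorm.\<close>

definition gagliardo_pow ::
  "real \<Rightarrow> real \<Rightarrow> 'a::euclidean_space set \<Rightarrow> ('a \<Rightarrow> real) \<Rightarrow> ennreal" where
  "gagliardo_pow s p U u =
     (\<integral>\<^sup>+x\<in>U. (\<integral>\<^sup>+y\<in>U. ennreal (\<bar>u x - u y\<bar> powr p
        / norm (x - y) powr (real DIM('a) + s * p)) \<partial>lebesgue) \<partial>lebesgue)"

text \<open>Functions on \<open>U\<close> are represented by total functions whose values off \<open>U\<close> are irrelevant.\<close>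

definition frac_sobolev ::
  "real \<Rightarrow> real \<Rightarrow> 'a::euclidean_space set \<Rightarrow> ('a \<Rightarrow> real) set" where
  "frac_sobolev s p U =
     {u. u \<in> borel_measurable (lebesgue_on U) \<and> Lnorm p U u < \<infinity> \<and> gagliardo_pow s p U u < \<infinity>}"

definition tail_space :: "real \<Rightarrow> real \<Rightarrow> ('a::euclidean_space \<Rightarrow> real) set" where
  "tail_space s p =
     {u. u \<in> borel_measurable lebesgue \<and>
         (\<integral>\<^sup>+x. ennreal (\<bar>u x\<bar> powr (p - 1)
            / (1 + norm x) powr (real DIM('a) + s * p)) \<partial>lebesgue) < \<infinity>}"

definition tail ::
  "real \<Rightarrow> real \<Rightarrow> ('a::euclidean_space \<Rightarrow> real) \<Rightarrow> 'a \<Rightarrow> real \<Rightarrow> ennreal" where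
  "tail s p u x0 R =
     epowr (\<integral>\<^sup>+x\<in>- ball x0 R. ennreal (\<bar>u x\<bar> powr (p - 1)
        / norm (x - x0) powr (real DIM('a) + s * p)) \<partial>lebesgue) (1 / (p - 1))"

datatype side = Plus | Minus

fun part :: "side \<Rightarrow> real \<Rightarrow> real" where
  "part Plus v = max v 0"
| "part Minus v = max (- v) 0"

fun level_set ::
  "side \<Rightarrow> ('a::euclidean_space \<Rightarrow> real) \<Rightarrow> real \<Rightarrow> 'a \<Rightarrow> real \<Rightarrow> 'a set" where
  "level_set Plus u k x0 R = {x. u x > k} \<inter> ball x0 R"
| "level_set Minus u k x0 R = {x. u x < k} \<inter> ball x0 R"

definition DG_rhs ::
  "side \<Rightarrow> real \<Rightarrow> real \<Rightarrow> real \<Rightarrow> real \<Rightarrow> real \<Rightarrow> ('a::euclidean_space \<Rightarrow> real)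
     \<Rightarrow> 'a \<Rightarrow> real \<Rightarrow> real \<Rightarrow> real \<Rightarrow> ennreal" where
  "DG_rhs \<sigma> s p d H lam u x0 r R k =
     (let w = (\<lambda>x. part \<sigma> (u x - k)); N = real DIM('a) + s * p in
      ennreal H *
       (ennreal (R powr lam * d powr p) * emeasure lebesgue (level_set \<sigma> u k x0 R)
        + ennreal (R powr ((1 - s) * p) / (R - r) powr p) * epowr (Lnorm p (ball x0 R) w) p
        + ennreal (R powr N / (R - r) powr N)
            * Lnorm 1 (ball x0 R) w * epowr (tail s p w x0 r) (p - 1)))"

definition weak_DG_side ::
  "side \<Rightarrow> real \<Rightarrow> real \<Rightarrow> 'a::euclidean_space set \<Rightarrow> real \<Rightarrow> real \<Rightarrow> real \<Rightarrow> ('a \<Rightarrow> real) set" where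
  "weak_DG_side \<sigma> s p \<Omega> d H lam =
     {u. u \<in> tail_space s p \<and> u \<in> frac_sobolev s p \<Omega> \<and>
         (\<forall>x0\<in>\<Omega>. \<forall>r R k. 0 < r \<and> r < R \<and> R < infdist x0 (frontier \<Omega>) \<longrightarrow>
            gagliardo_pow s p (ball x0 r) (\<lambda>x. part \<sigma> (u x - k))
              \<le> DG_rhs \<sigma> s p d H lam u x0 r R k)}"

definition weak_DG ::
  "real \<Rightarrow> real \<Rightarrow> 'a::euclidean_space set \<Rightarrow> real \<Rightarrow> real \<Rightarrow> real \<Rightarrow> ('a \<Rightarrow> real) set" where
  "weak_DG s p \<Omega> d H lam = weak_DG_side Plus s p \<Omega> d H lam \<inter> weak_DG_side Minus s p \<Omega> d H lam"

definition strong_DG_minus ::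
  "real \<Rightarrow> real \<Rightarrow> 'a::euclidean_space set \<Rightarrow> real \<Rightarrow> real \<Rightarrow> real \<Rightarrow> ('a \<Rightarrow> real) set" where
  "strong_DG_minus s p \<Omega> d H lam =
     {u. u \<in> tail_space s p \<and> u \<in> frac_sobolev s p \<Omega> \<and>
         (\<forall>x0\<in>\<Omega>. \<forall>r R k. 0 < r \<and> r < R \<and> R < infdist x0 (frontier \<Omega>) \<longrightarrow>
            gagliardo_pow s p (ball x0 r) (\<lambda>x. part Minus (u x - k))
            + (\<integral>\<^sup>+x\<in>ball x0 r. ennreal (part Minus (u x - k))
                 * (\<integral>\<^sup>+y. ennreal (part Plus (u y - k) powr (p - 1)
                      / norm (x - y) powr (real DIM('a) + s * p)) \<partial>lebesgue) \<partial>lebesgue)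
              \<le> DG_rhs Minus s p d H lam u x0 r R k)}"

end

theory Submission
  imports Defs
begin

text \<open>
  Both halves rest on the scaling of a single jump. Write \<open>a = s * p < 1\<close>. A jump at \<open>0\<close> has finite
  Gagliardo energy, because \<open>\<integral>\<^sub>0\<^sup>c (\<integral>\<^bsub>-\<infinity>\<^esub>\<^sup>0 (x - y) powr - (1 + a) dy) dx = c powr (1 - a) / (a * (1 - a))\<close>.

  \<^emph>\<open>Membership.\<close> Every truncation of the half-line function is a nonnegative step \<open>step A B\<close>, with value
  \<open>A\<close> to the right of \<open>0\<close> and \<open>B\<close> elsewhere. If \<open>\<bar>x0\<bar> \<ge> r\<close>, it is constant on the ball of radius \<open>r\<close>
  and there is nothing to show. Otherwise the kernel can be integrated over a whole
  half-line on either side of the jump, so the energy is at most a constant times \<open>\<bar>A - B\<bar> powr p\<close> times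
  the power \<open>1 - a\<close> of the length of the \<^emph>\<open>shorter\<close> of the two pieces into which \<open>0\<close> cuts the ball (lemma
  \<open>interaction_across_0_le\<close>). Let \<open>M = max A B\<close> and let \<open>L\<close> be the length of the piece of the larger
  ball on which the step equals \<open>M\<close>. Since \<open>x0\<close> is within \<open>r\<close> of the jump, \<open>R - r \<le> L\<close>, hence
  \<open>R powr ((1 - s) * p) / (R - r) powr p \<ge> (R - r) powr - a \<ge> L powr - a\<close>, and the \<open>L\<^sup>p\<close> term of the
  Caccioppoli inequality is at least \<open>L powr - a * (M powr p * L) = M powr p * L powr (1 - a)\<close>. This
  dominates the energy, with the same constant for all centres, radii and levels (lemma
  \<open>step_Caccioppoli\<close>).

  \<^emph>\<open>Failure.\<close> Take \<open>x0 = 0\<close>, \<open>R = 2 * r\<close> and a small level \<open>k > 0\<close>. The mixed term pairs the values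
  \<open>k\<close> on the left with the values \<open>1 - k\<close> on the right, so it is of order \<open>k * r powr (1 - a)\<close>, linear
  in \<open>k\<close> (lemma \<open>mixed_term_ge\<close>). On the right-hand side the \<open>L\<^sup>p\<close> and tail terms are of order
  \<open>k powr p * r powr (1 - a)\<close>, and the level-set term is \<open>O(r)\<close> (lemma \<open>DG_rhs_step_at_0\<close>). Letting
  first \<open>r\<close> and then \<open>k\<close> tend to \<open>0\<close> contradicts \<open>p > 1\<close>, whatever \<open>d\<close>, \<open>lam\<close> and \<open>H\<close> are.
\<close>

section \<open>Integrals of the one-dimensional kernels\<close>

lemma nn_integral_halfline_kernel:
  fixes a c x :: real
  assumes "0 < a" "0 < c"
  shows "(\<integral>\<^sup>+y\<in>{x + c..}. ennreal (1 / \<bar>x - y\<bar> powr (1 + a)) \<partial>lborel) = ennreal (c powr - a / a)"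
    and "(\<integral>\<^sup>+y\<in>{..x - c}. ennreal (1 / \<bar>x - y\<bar> powr (1 + a)) \<partial>lborel) = ennreal (c powr - a / a)"
proof -
  have "(\<integral>\<^sup>+t. ennreal (t powr - (1 + a)) * indicator {c..} t \<partial>lborel)
      = ennreal (- (c powr (- (1 + a) + 1)) / (- (1 + a) + 1))"
    using assms by (intro nn_integral_has_integral_lebesgue' has_integral_powr_to_inf) auto
  then have base: "(\<integral>\<^sup>+t. ennreal (t powr - (1 + a)) * indicator {c..} t \<partial>lborel) = ennreal (c powr - a / a)"
    by simp
  have "(\<integral>\<^sup>+y\<in>{x + c..}. ennreal (1 / \<bar>x - y\<bar> powr (1 + a)) \<partial>lborel)
      = (\<integral>\<^sup>+t. ennreal (1 / \<bar>x - (x + 1 * t)\<bar> powr (1 + a)) * indicator {x + c..} (x + 1 * t) \<partial>lborel)"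
    by (subst nn_integral_real_affine[where c = 1 and t = x]) auto
  also have "\<dots> = (\<integral>\<^sup>+t. ennreal (t powr - (1 + a)) * indicator {c..} t \<partial>lborel)"
    using assms by (intro nn_integral_cong) (auto simp: indicator_def simp flip: powr_minus_divide)
  finally show "(\<integral>\<^sup>+y\<in>{x + c..}. ennreal (1 / \<bar>x - y\<bar> powr (1 + a)) \<partial>lborel) = ennreal (c powr - a / a)"
    using base by simp
  have "(\<integral>\<^sup>+y\<in>{..x - c}. ennreal (1 / \<bar>x - y\<bar> powr (1 + a)) \<partial>lborel)
      = (\<integral>\<^sup>+t. ennreal (1 / \<bar>x - (x + - 1 * t)\<bar> powr (1 + a)) * indicator {..x - c} (x + - 1 * t) \<partial>lborel)"
    by (subst nn_integral_real_affine[where c = "- 1" and t = x]) auto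
  also have "\<dots> = (\<integral>\<^sup>+t. ennreal (t powr - (1 + a)) * indicator {c..} t \<partial>lborel)"
    using assms by (intro nn_integral_cong) (auto simp: indicator_def simp flip: powr_minus_divide)
  finally show "(\<integral>\<^sup>+y\<in>{..x - c}. ennreal (1 / \<bar>x - y\<bar> powr (1 + a)) \<partial>lborel) = ennreal (c powr - a / a)"
    using base by simp
qed

lemma nn_integral_powr_near_0:
  fixes a c :: real
  assumes "a < 1" "0 \<le> c"
  shows "(\<integral>\<^sup>+t\<in>{0..c}. ennreal (\<bar>t\<bar> powr - a) \<partial>lborel) = ennreal (c powr (1 - a) / (1 - a))"
    and "(\<integral>\<^sup>+t\<in>{- c..0}. ennreal (\<bar>t\<bar> powr - a) \<partial>lborel) = ennreal (c powr (1 - a) / (1 - a))"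
proof -
  have "(\<integral>\<^sup>+t. ennreal (t powr - a) * indicator {0..c} t \<partial>lborel)
      = ennreal (c powr (- a + 1) / (- a + 1))"
    using assms by (intro nn_integral_has_integral_lebesgue' has_integral_powr_from_0) auto
  moreover have "(\<integral>\<^sup>+t. ennreal (t powr - a) * indicator {0..c} t \<partial>lborel)
      = (\<integral>\<^sup>+t\<in>{0..c}. ennreal (\<bar>t\<bar> powr - a) \<partial>lborel)"
    by (intro nn_integral_cong) (auto simp: indicator_def)
  ultimately show *: "(\<integral>\<^sup>+t\<in>{0..c}. ennreal (\<bar>t\<bar> powr - a) \<partial>lborel) = ennreal (c powr (1 - a) / (1 - a))"
    by simp
  have "(\<integral>\<^sup>+t\<in>{- c..0}. ennreal (\<bar>t\<bar> powr - a) \<partial>lborel)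
      = (\<integral>\<^sup>+t. ennreal (\<bar>0 + - 1 * t\<bar> powr - a) * indicator {- c..0} (0 + - 1 * t) \<partial>lborel)"
    by (subst nn_integral_real_affine[where c = "- 1" and t = 0]) auto
  also have "\<dots> = (\<integral>\<^sup>+t\<in>{0..c}. ennreal (\<bar>t\<bar> powr - a) \<partial>lborel)"
    by (intro nn_integral_cong) (auto simp: indicator_def)
  finally show "(\<integral>\<^sup>+t\<in>{- c..0}. ennreal (\<bar>t\<bar> powr - a) \<partial>lborel) = ennreal (c powr (1 - a) / (1 - a))"
    using * by simp
qed

text \<open>
  The energy carried by a unit jump between two disjoint sets. Estimating it as an iterated integral
  yields a bound by the length of the outer set only, so its symmetry is what makes both
  lengths available.
\<close>

definition interaction :: "real \<Rightarrow> real set \<Rightarrow> real set \<Rightarrow> ennreal" where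
  "interaction a A B =
     (\<integral>\<^sup>+x\<in>A. (\<integral>\<^sup>+y\<in>B. ennreal (1 / \<bar>x - y\<bar> powr (1 + a)) \<partial>lborel) \<partial>lborel)"

lemma interaction_commute:
  assumes [measurable]: "A \<in> sets borel" "B \<in> sets borel"
  shows "interaction a A B = interaction a B A"
proof -
  let ?k = "\<lambda>x y. ennreal (1 / \<bar>x - y\<bar> powr (1 + a))"
  have "interaction a A B = (\<integral>\<^sup>+x. (\<integral>\<^sup>+y. ?k x y * indicator B y * indicator A x \<partial>lborel) \<partial>lborel)"
    unfolding interaction_def by (intro nn_integral_cong) (simp add: nn_integral_multc)
  also have "\<dots> = (\<integral>\<^sup>+y. (\<integral>\<^sup>+x. ?k x y * indicator B y * indicator A x \<partial>lborel) \<partial>lborel)"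
    by (rule lborel_pair.Fubini'[symmetric]) measurable
  also have "\<dots> = (\<integral>\<^sup>+y. (\<integral>\<^sup>+x. ?k y x * indicator A x * indicator B y \<partial>lborel) \<partial>lborel)"
    by (intro nn_integral_cong) (simp add: abs_minus_commute mult_ac)
  also have "\<dots> = interaction a B A"
    unfolding interaction_def by (intro nn_integral_cong) (simp add: nn_integral_multc)
  finally show ?thesis .
qed

lemma interaction_mono:
  assumes "A \<subseteq> A'" "B \<subseteq> B'"
  shows "interaction a A B \<le> interaction a A' B'"
  unfolding interaction_def using assms
  by (intro nn_integral_mono mult_mono) (auto simp: indicator_def)

text \<open>
  Integrating the kernel over the whole opposite half-line leaves \<open>\<bar>x\<bar> powr - a / a\<close>, which is
  integrable at \<open>0\<close> precisely because \<open>a < 1\<close>.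
\<close>

lemma interaction_interval_halfline_le:
  fixes a c :: real
  assumes "0 < a" "a < 1" "0 \<le> c"
  shows "interaction a {0<..c} {..0} \<le> ennreal (c powr (1 - a) / (a * (1 - a)))"
    and "interaction a {- c..0} {0<..} \<le> ennreal (c powr (1 - a) / (a * (1 - a)))"
proof -
  have scale: "ennreal (1 / a) * ennreal (c powr (1 - a) / (1 - a)) = ennreal (c powr (1 - a) / (a * (1 - a)))"
    using assms by (simp add: ennreal_mult[symmetric])
  have "interaction a {0<..c} {..0} \<le> (\<integral>\<^sup>+x. ennreal (1 / a) * (ennreal (\<bar>x\<bar> powr - a) * indicator {0..c} x) \<partial>lborel)"
    unfolding interaction_def
  proof (intro nn_integral_mono)
    fix x :: real
    have "(\<integral>\<^sup>+y\<in>{..0}. ennreal (1 / \<bar>x - y\<bar> powr (1 + a)) \<partial>lborel) = ennreal (1 / a) * ennreal (\<bar>x\<bar> powr - a)" if "0 < x"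
      using nn_integral_halfline_kernel(2)[OF assms(1) that, of x] assms(1) that
      by (simp add: ennreal_mult[symmetric])
    then show "(\<integral>\<^sup>+y\<in>{..0}. ennreal (1 / \<bar>x - y\<bar> powr (1 + a)) \<partial>lborel) * indicator {0<..c} x
        \<le> ennreal (1 / a) * (ennreal (\<bar>x\<bar> powr - a) * indicator {0..c} x)"
      by (auto simp: indicator_def)
  qed
  also have "\<dots> = ennreal (c powr (1 - a) / (a * (1 - a)))"
    using assms by (subst nn_integral_cmult) (auto simp: nn_integral_powr_near_0 scale)
  finally show "interaction a {0<..c} {..0} \<le> ennreal (c powr (1 - a) / (a * (1 - a)))" .
  have "interaction a {- c..0} {0<..} \<le> (\<integral>\<^sup>+x. ennreal (1 / a) * (ennreal (\<bar>x\<bar> powr - a) * indicator {- c..0} x) \<partial>lborel)"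
    unfolding interaction_def
    \<comment> \<open>At \<open>x = 0\<close> the inner integral diverges, while \<open>0 powr - a = 0\<close>; hence only almost everywhere.\<close>
  proof (intro nn_integral_mono_AE, use AE_lborel_singleton[of 0] in eventually_elim)
    fix x :: real
    assume "x \<noteq> 0"
    have "(\<integral>\<^sup>+y\<in>{0<..}. ennreal (1 / \<bar>x - y\<bar> powr (1 + a)) \<partial>lborel) \<le> ennreal (1 / a) * ennreal (\<bar>x\<bar> powr - a)" if "x < 0"
    proof -
      have "(\<integral>\<^sup>+y\<in>{0<..}. ennreal (1 / \<bar>x - y\<bar> powr (1 + a)) \<partial>lborel)
          \<le> (\<integral>\<^sup>+y\<in>{0..}. ennreal (1 / \<bar>x - y\<bar> powr (1 + a)) \<partial>lborel)"
        by (intro nn_integral_mono) (auto simp: indicator_def)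
      also have "\<dots> = ennreal (1 / a) * ennreal (\<bar>x\<bar> powr - a)"
        using nn_integral_halfline_kernel(1)[OF assms(1), of "- x" x] assms(1) that
        by (simp add: ennreal_mult[symmetric])
      finally show ?thesis .
    qed
    then show "(\<integral>\<^sup>+y\<in>{0<..}. ennreal (1 / \<bar>x - y\<bar> powr (1 + a)) \<partial>lborel) * indicator {- c..0} x
        \<le> ennreal (1 / a) * (ennreal (\<bar>x\<bar> powr - a) * indicator {- c..0} x)"
      using \<open>x \<noteq> 0\<close> by (auto simp: indicator_def)
  qed
  also have "\<dots> = ennreal (c powr (1 - a) / (a * (1 - a)))"
    using assms by (subst nn_integral_cmult) (auto simp: nn_integral_powr_near_0 scale)
  finally show "interaction a {- c..0} {0<..} \<le> ennreal (c powr (1 - a) / (a * (1 - a)))" .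
qed

lemma interaction_across_0_le:
  fixes a \<alpha> \<beta> :: real
  assumes "0 < a" "a < 1" "\<alpha> < 0" "0 < \<beta>"
  shows "interaction a {0<..<\<beta>} {\<alpha><..0} \<le> ennreal (min \<beta> (- \<alpha>) powr (1 - a) / (a * (1 - a)))"
proof -
  have "interaction a {0<..<\<beta>} {\<alpha><..0} \<le> interaction a {0<..\<beta>} {..0}"
    by (intro interaction_mono) auto
  also have "\<dots> \<le> ennreal (\<beta> powr (1 - a) / (a * (1 - a)))"
    using assms by (intro interaction_interval_halfline_le) auto
  finally have right: "interaction a {0<..<\<beta>} {\<alpha><..0} \<le> ennreal (\<beta> powr (1 - a) / (a * (1 - a)))" .
  have "interaction a {0<..<\<beta>} {\<alpha><..0} = interaction a {\<alpha><..0} {0<..<\<beta>}"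
    by (intro interaction_commute) auto
  also have "\<dots> \<le> interaction a {- (- \<alpha>)..0} {0<..}"
    by (intro interaction_mono) auto
  also have "\<dots> \<le> ennreal ((- \<alpha>) powr (1 - a) / (a * (1 - a)))"
    using assms by (intro interaction_interval_halfline_le) auto
  finally show ?thesis
    using right by (simp add: min_def)
qed

section \<open>Energy of a step function\<close>

definition step :: "real \<Rightarrow> real \<Rightarrow> real \<Rightarrow> real" where
  "step a b x = (if 0 < x then a else b)"

lemma measurable_step [measurable]: "step a b \<in> borel_measurable borel"
  unfolding step_def[abs_def] by measurable

text \<open>
  Only pairs of points on opposite sides of \<open>0\<close> contribute; the factor \<open>2\<close> accounts for the two
  orders of such a pair.
\<close>

lemma gagliardo_pow_step:
  fixes s p A B \<alpha> \<beta> :: real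
  shows "gagliardo_pow s p {\<alpha><..<\<beta>} (step A B)
    \<le> ennreal (2 * \<bar>A - B\<bar> powr p) * interaction (s * p) {0<..<\<beta>} {\<alpha><..0}"
proof -
  let ?P = "{0<..<\<beta>}" and ?Q = "{\<alpha><..0}"
  let ?D = "ennreal (\<bar>A - B\<bar> powr p)"
  let ?k = "\<lambda>x y. ennreal (1 / \<bar>x - y\<bar> powr (1 + s * p))"
  have "gagliardo_pow s p {\<alpha><..<\<beta>} (step A B)
      = (\<integral>\<^sup>+x\<in>{\<alpha><..<\<beta>}. (\<integral>\<^sup>+y\<in>{\<alpha><..<\<beta>}. ennreal (\<bar>step A B x - step A B y\<bar> powr p / \<bar>x - y\<bar> powr (1 + s * p)) \<partial>lborel) \<partial>lborel)"
    by (simp add: gagliardo_pow_def nn_integral_completion)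
  also have "\<dots> \<le> (\<integral>\<^sup>+x. ?D * ((\<integral>\<^sup>+y\<in>?Q. ?k x y \<partial>lborel) * indicator ?P x)
        + ?D * ((\<integral>\<^sup>+y\<in>?P. ?k x y \<partial>lborel) * indicator ?Q x) \<partial>lborel)"
  proof (intro nn_integral_mono)
    fix x :: real
    have "(\<integral>\<^sup>+y\<in>{\<alpha><..<\<beta>}. ennreal (\<bar>step A B x - step A B y\<bar> powr p / \<bar>x - y\<bar> powr (1 + s * p)) \<partial>lborel)
        \<le> (\<integral>\<^sup>+y. ?D * (?k x y * indicator ?Q y) \<partial>lborel)" if "0 < x"
      using that by (intro nn_integral_mono) (auto simp: indicator_def step_def ennreal_mult[symmetric])
    moreover have "(\<integral>\<^sup>+y\<in>{\<alpha><..<\<beta>}. ennreal (\<bar>step A B x - step A B y\<bar> powr p / \<bar>x - y\<bar> powr (1 + s * p)) \<partial>lborel)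
        \<le> (\<integral>\<^sup>+y. ?D * (?k x y * indicator ?P y) \<partial>lborel)" if "x \<le> 0"
      using that
      by (intro nn_integral_mono) (auto simp: indicator_def step_def ennreal_mult[symmetric] abs_minus_commute)
    ultimately show "(\<integral>\<^sup>+y\<in>{\<alpha><..<\<beta>}. ennreal (\<bar>step A B x - step A B y\<bar> powr p / \<bar>x - y\<bar> powr (1 + s * p)) \<partial>lborel)
          * indicator {\<alpha><..<\<beta>} x
        \<le> ?D * ((\<integral>\<^sup>+y\<in>?Q. ?k x y \<partial>lborel) * indicator ?P x)
        + ?D * ((\<integral>\<^sup>+y\<in>?P. ?k x y \<partial>lborel) * indicator ?Q x)"
      by (auto simp: indicator_def nn_integral_cmult)
  qed
  also have "\<dots> = ?D * interaction (s * p) ?P ?Q + ?D * interaction (s * p) ?Q ?P"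
    unfolding interaction_def by (subst nn_integral_add) (auto simp: nn_integral_cmult)
  also have "\<dots> = ?D * interaction (s * p) ?P ?Q + ?D * interaction (s * p) ?P ?Q"
    by (subst (2) interaction_commute) auto
  also have "\<dots> = ennreal (2 * \<bar>A - B\<bar> powr p) * interaction (s * p) ?P ?Q"
    by (simp add: ennreal_mult mult.assoc flip: mult_2)
  finally show ?thesis .
qed

lemma interaction_empty: "interaction a {} B = 0" "interaction a A {} = 0"
  by (simp_all add: interaction_def)

text \<open>One bound for each piece of the ball, to be applied to the piece with the larger value.\<close>

lemma nn_integral_step_ge:
  fixes A B x0 R p :: real
  assumes "\<bar>x0\<bar> < R" "0 \<le> A" "0 \<le> B"
  shows "ennreal (A powr p * (R + x0)) \<le> (\<integral>\<^sup>+x\<in>ball x0 R. ennreal (\<bar>step A B x\<bar> powr p) \<partial>lebesgue)"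
    and "ennreal (B powr p * (R - x0)) \<le> (\<integral>\<^sup>+x\<in>ball x0 R. ennreal (\<bar>step A B x\<bar> powr p) \<partial>lebesgue)"
proof -
  have "ennreal (A powr p * (R + x0)) = (\<integral>\<^sup>+x. ennreal (A powr p) * indicator {0<..<R + x0} x \<partial>lborel)"
    using assms by (subst nn_integral_cmult_indicator) (auto simp: ennreal_mult)
  also have "\<dots> \<le> (\<integral>\<^sup>+x\<in>ball x0 R. ennreal (\<bar>step A B x\<bar> powr p) \<partial>lborel)"
    using assms by (intro nn_integral_mono) (auto simp: indicator_def step_def dist_real_def)
  finally show "ennreal (A powr p * (R + x0)) \<le> (\<integral>\<^sup>+x\<in>ball x0 R. ennreal (\<bar>step A B x\<bar> powr p) \<partial>lebesgue)"
    by (simp add: nn_integral_completion)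
  have "ennreal (B powr p * (R - x0)) = (\<integral>\<^sup>+x. ennreal (B powr p) * indicator {x0 - R<..0} x \<partial>lborel)"
    using assms by (subst nn_integral_cmult_indicator) (auto simp: ennreal_mult)
  also have "\<dots> \<le> (\<integral>\<^sup>+x\<in>ball x0 R. ennreal (\<bar>step A B x\<bar> powr p) \<partial>lborel)"
    using assms by (intro nn_integral_mono) (auto simp: indicator_def step_def dist_real_def)
  finally show "ennreal (B powr p * (R - x0)) \<le> (\<integral>\<^sup>+x\<in>ball x0 R. ennreal (\<bar>step A B x\<bar> powr p) \<partial>lebesgue)"
    by (simp add: nn_integral_completion)
qed

text \<open>
  The factor \<open>R powr ((1 - s) * p) / (R - r) powr p\<close> in front of the \<open>L\<^sup>p\<close> norm is at least
  \<open>(R - r) powr - (s * p)\<close>, so it turns a length \<open>L \<ge> R - r\<close> into the power of \<open>L\<close> with which the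
  energy of a jump scales.
\<close>

lemma Caccioppoli_weight_ge:
  fixes s p r R L :: real
  assumes "0 < s" "s < 1" "1 < p" "0 < r" "r < R" "R - r \<le> L"
  shows "L powr (1 - s * p) \<le> R powr ((1 - s) * p) / (R - r) powr p * L"
proof -
  have "L powr (1 - s * p) = L powr - (s * p) * L"
    using assms powr_mult_base[of L "- (s * p)"] by (simp add: mult.commute)
  also have "\<dots> \<le> (R - r) powr - (s * p) * L"
    using assms by (intro mult_right_mono powr_mono2') auto
  also have "(R - r) powr - (s * p) = (R - r) powr ((1 - s) * p) / (R - r) powr p"
    by (simp add: powr_diff[symmetric] algebra_simps)
  also have "\<dots> * L \<le> R powr ((1 - s) * p) / (R - r) powr p * L"
    using assms by (intro mult_right_mono divide_right_mono powr_mono2) auto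
  finally show ?thesis .
qed

text \<open>
  The energy is governed by the shorter piece \<open>?l\<close> of the small ball, and therefore by the piece
  of the large ball that carries the larger value, whichever side that is.
\<close>

lemma step_Caccioppoli:
  fixes s p A B x0 r R :: real
  assumes sp: "0 < s" "s < 1" "1 < p" "s * p < 1"
    and r: "0 < r" "r < R" and AB: "0 \<le> A" "0 \<le> B"
  shows "gagliardo_pow s p (ball x0 r) (step A B)
    \<le> ennreal (2 / (s * p * (1 - s * p)))
        * (ennreal (R powr ((1 - s) * p) / (R - r) powr p)
           * (\<integral>\<^sup>+x\<in>ball x0 R. ennreal (\<bar>step A B x\<bar> powr p) \<partial>lebesgue))"
proof (cases "\<bar>x0\<bar> < r")
  case False
  then have "interaction (s * p) {0<..<x0 + r} {x0 - r<..0} = 0"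
    by (cases "x0 > 0") (simp_all add: interaction_empty)
  then have "gagliardo_pow s p {x0 - r<..<x0 + r} (step A B) \<le> 0"
    using gagliardo_pow_step[of s p "x0 - r" "x0 + r" A B] by simp
  then show ?thesis
    by (simp add: ball_eq_greaterThanLessThan)
next
  case True
  let ?a = "s * p"
  let ?l = "min (x0 + r) (r - x0)"
  let ?W = "R powr ((1 - s) * p) / (R - r) powr p"
  let ?I = "\<integral>\<^sup>+x\<in>ball x0 R. ennreal (\<bar>step A B x\<bar> powr p) \<partial>lebesgue"
  have a: "0 < ?a" "?a < 1" using sp by auto
  have side: "ennreal (\<bar>A - B\<bar> powr p * ?l powr (1 - ?a)) \<le> ennreal ?W * ?I"
    if M: "0 \<le> M" "\<bar>A - B\<bar> \<le> M" and L: "?l \<le> L" "R - r \<le> L"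
      and big: "ennreal (M powr p * L) \<le> ?I" for M L
  proof -
    have "\<bar>A - B\<bar> powr p * ?l powr (1 - ?a) \<le> M powr p * L powr (1 - ?a)"
      using sp M L True by (intro mult_mono powr_mono2) auto
    also have "\<dots> \<le> M powr p * (?W * L)"
      using sp r L by (intro mult_left_mono Caccioppoli_weight_ge) auto
    also have "\<dots> = ?W * (M powr p * L)" by simp
    finally have "ennreal (\<bar>A - B\<bar> powr p * ?l powr (1 - ?a)) \<le> ennreal ?W * ennreal (M powr p * L)"
      using L r by (simp add: ennreal_mult[symmetric] del: times_divide_eq_left)
    also have "\<dots> \<le> ennreal ?W * ?I"
      using big by (rule mult_left_mono) simp
    finally show ?thesis .
  qed
  have key: "ennreal (\<bar>A - B\<bar> powr p * ?l powr (1 - ?a)) \<le> ennreal ?W * ?I"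
  proof (cases "B \<le> A")
    case True
    then show ?thesis
      using AB r \<open>\<bar>x0\<bar> < r\<close> nn_integral_step_ge(1)[of x0 R A B p] by (intro side[of A "R + x0"]) auto
  next
    case False
    then show ?thesis
      using AB r \<open>\<bar>x0\<bar> < r\<close> nn_integral_step_ge(2)[of x0 R A B p] by (intro side[of B "R - x0"]) auto
  qed
  have "gagliardo_pow s p (ball x0 r) (step A B)
      \<le> ennreal (2 * \<bar>A - B\<bar> powr p) * interaction ?a {0<..<x0 + r} {x0 - r<..0}"
    using gagliardo_pow_step[of s p] by (simp add: ball_eq_greaterThanLessThan)
  also have "\<dots> \<le> ennreal (2 * \<bar>A - B\<bar> powr p) * ennreal (?l powr (1 - ?a) / (?a * (1 - ?a)))"
    using interaction_across_0_le[OF a, of "x0 - r" "x0 + r"] True by (intro mult_left_mono) auto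
  also have "\<dots> = ennreal (2 / (?a * (1 - ?a))) * ennreal (\<bar>A - B\<bar> powr p * ?l powr (1 - ?a))"
    using a by (simp add: ennreal_mult[symmetric])
  also have "\<dots> \<le> ennreal (2 / (?a * (1 - ?a))) * (ennreal ?W * ?I)"
    using key by (rule mult_left_mono) simp
  finally show ?thesis .
qed

section \<open>Membership in the weak class\<close>

lemma epowr_epowr_inverse:
  assumes "0 < q"
  shows "epowr (epowr x (1 / q)) q = x"
  using assms by (cases x) (auto simp: epowr_def powr_powr)

lemma indicator_eq_step: "indicator {0<..} = step 1 0"
  by (auto simp: step_def indicator_def)

lemma part_step: "(\<lambda>x. part \<sigma> (step A B x - k)) = step (part \<sigma> (A - k)) (part \<sigma> (B - k))"
  by (auto simp: step_def)

lemma part_nonneg: "0 \<le> part \<sigma> v"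
  by (cases \<sigma>) auto

lemma DG_rhs_ge_Lp_term:
  fixes u :: "real \<Rightarrow> real"
  assumes "0 < p"
  shows "ennreal H * (ennreal (R powr ((1 - s) * p) / (R - r) powr p)
      * (\<integral>\<^sup>+x\<in>ball x0 R. ennreal (\<bar>part \<sigma> (u x - k)\<bar> powr p) \<partial>lebesgue))
    \<le> DG_rhs \<sigma> s p d H lam u x0 r R k"
  unfolding DG_rhs_def Let_def Lnorm_def epowr_epowr_inverse[OF assms]
  by (intro mult_left_mono) (auto intro: add_increasing add_increasing2)

lemma step_in_tail_space:
  assumes "0 < s * p"
  shows "step 1 0 \<in> tail_space s p"
proof -
  have "(\<integral>\<^sup>+x. ennreal (\<bar>step 1 0 x\<bar> powr (p - 1) / (1 + norm x) powr (real DIM(real) + s * p)) \<partial>lborel)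
      \<le> (\<integral>\<^sup>+y\<in>{-1 + 1..}. ennreal (1 / \<bar>-1 - y\<bar> powr (1 + s * p)) \<partial>lborel)"
    by (intro nn_integral_mono) (auto simp: step_def indicator_def add.commute)
  also have "\<dots> < \<infinity>"
    using assms by (subst nn_integral_halfline_kernel) auto
  finally show ?thesis
    by (simp add: tail_space_def nn_integral_completion measurable_completion)
qed

lemma step_in_frac_sobolev:
  assumes "0 < s * p" "s * p < 1"
  shows "step 1 0 \<in> frac_sobolev s p {-1<..<1}"
proof -
  have "(\<integral>\<^sup>+x\<in>{-1<..<1}. ennreal (\<bar>step 1 0 x\<bar> powr p) \<partial>lborel)
      \<le> (\<integral>\<^sup>+x. indicator {-1<..<1::real} x \<partial>lborel)"
    by (intro nn_integral_mono) (auto simp: step_def indicator_def)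
  also have "\<dots> < \<infinity>"
    by simp
  finally have "Lnorm p {-1<..<1} (step 1 0) < \<infinity>"
    by (auto simp: Lnorm_def epowr_def nn_integral_completion)
  moreover have "gagliardo_pow s p {-1<..<1} (step 1 0) < \<infinity>"
  proof -
    have "gagliardo_pow s p {-1<..<1} (step 1 0)
        \<le> ennreal 2 * interaction (s * p) {0<..<1} {-1<..0}"
      using gagliardo_pow_step[of s p "-1" 1 1 0] by simp
    also have "\<dots> \<le> ennreal 2 * ennreal (min 1 (- (-1)) powr (1 - s * p) / (s * p * (1 - s * p)))"
      using assms by (intro mult_left_mono interaction_across_0_le) auto
    also have "\<dots> < \<infinity>"
      by (simp add: ennreal_mult_less_top)
    finally show ?thesis .
  qed
  moreover have "step 1 0 \<in> borel_measurable (lebesgue_on {-1<..<1})"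
    by (intro measurable_restrict_space1 measurable_completion) simp
  ultimately show ?thesis
    by (simp add: frac_sobolev_def)
qed

lemma step_in_weak_DG_side:
  assumes sp: "0 < s" "s < 1" "1 < p" "s * p < 1"
    and H: "2 / (s * p * (1 - s * p)) \<le> H"
  shows "step 1 0 \<in> weak_DG_side \<sigma> s p {-1<..<1} 0 H 0"
proof -
  have "gagliardo_pow s p (ball x0 r) (\<lambda>x. part \<sigma> (step 1 0 x - k)) \<le> DG_rhs \<sigma> s p 0 H 0 (step 1 0) x0 r R k"
    if r: "0 < r" "r < R" for x0 r R k
  proof -
    let ?E = "ennreal (R powr ((1 - s) * p) / (R - r) powr p)
      * (\<integral>\<^sup>+x\<in>ball x0 R. ennreal (\<bar>part \<sigma> (step 1 0 x - k)\<bar> powr p) \<partial>lebesgue)"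
    have "gagliardo_pow s p (ball x0 r) (\<lambda>x. part \<sigma> (step 1 0 x - k))
        \<le> ennreal (2 / (s * p * (1 - s * p))) * ?E"
      using step_Caccioppoli[OF sp r part_nonneg part_nonneg] by (simp add: part_step fun_cong[OF part_step])
    also have "\<dots> \<le> ennreal H * ?E"
      using H by (intro mult_right_mono ennreal_leI) auto
    also have "\<dots> \<le> DG_rhs \<sigma> s p 0 H 0 (step 1 0) x0 r R k"
      using sp by (intro DG_rhs_ge_Lp_term) auto
    finally show ?thesis .
  qed
  moreover have "0 < s * p" using sp by simp
  ultimately show ?thesis
    using step_in_tail_space step_in_frac_sobolev sp by (simp add: weak_DG_side_def)
qed

section \<open>Failure of the strong condition\<close>

lemma infdist_0_frontier_interval: "infdist (0::real) (frontier {-1<..<1}) = 1"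
proof -
  have "frontier {-1<..<1::real} = sphere 0 1"
    using frontier_ball[of 1 "0::real"] by (simp add: ball_eq_greaterThanLessThan)
  moreover have "1 \<in> sphere (0::real) 1"
    by simp
  then have "infdist (0::real) (sphere 0 1) = (INF y\<in>sphere (0::real) 1. 1)"
    by (subst infdist_notempty) (auto intro!: INF_cong)
  ultimately show ?thesis
    using \<open>1 \<in> sphere (0::real) 1\<close> by (metis cINF_const empty_iff)
qed

text \<open>
  Within the square \<open>(- r, 0] \<times> (0, r)\<close> the kernel is at least \<open>(2 * r) powr - (1 + s * p)\<close>; this
  crude bound already has the right scaling in \<open>r\<close> and the linear factor \<open>k\<close> that matters.
\<close>

lemma mixed_term_ge:
  fixes s p k r :: real
  assumes "0 < s * p" "1 < p" "0 < r" "0 < k" "k < 1"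
  shows "ennreal (k * (1 - k) powr (p - 1) * 2 powr - (1 + s * p) * r powr (1 - s * p))
    \<le> (\<integral>\<^sup>+x\<in>ball 0 r. ennreal (part Minus (step 1 0 x - k))
         * (\<integral>\<^sup>+y. ennreal (part Plus (step 1 0 y - k) powr (p - 1)
              / norm (x - y) powr (real DIM(real) + s * p)) \<partial>lebesgue) \<partial>lebesgue)"
proof -
  let ?N = "1 + s * p"
  let ?c = "(1 - k) powr (p - 1) * (2 * r) powr - ?N"
  have inner: "ennreal (?c * r) \<le> (\<integral>\<^sup>+y. ennreal (part Plus (step 1 0 y - k) powr (p - 1)
              / norm (x - y) powr ?N) \<partial>lborel)" if x: "- r < x" "x \<le> 0" for x
  proof -
    have "ennreal (?c * r) = (\<integral>\<^sup>+y. ennreal ?c * indicator {0<..<r} y \<partial>lborel)"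
      using assms by (subst nn_integral_cmult_indicator) (auto simp: ennreal_mult)
    also have "\<dots> \<le> (\<integral>\<^sup>+y. ennreal (part Plus (step 1 0 y - k) powr (p - 1) / norm (x - y) powr ?N) \<partial>lborel)"
    proof (intro nn_integral_mono)
      fix y :: real
      have "?c \<le> (1 - k) powr (p - 1) / \<bar>x - y\<bar> powr ?N" if y: "0 < y" "y < r"
      proof -
        have "(2 * r) powr - ?N \<le> \<bar>x - y\<bar> powr - ?N"
          using assms x y by (intro powr_mono2') auto
        then have "?c \<le> (1 - k) powr (p - 1) * \<bar>x - y\<bar> powr - ?N"
          by (intro mult_left_mono) auto
        then show ?thesis
          by (simp only: powr_minus_divide) simp
      qed
      then show "ennreal ?c * indicator {0<..<r} y
          \<le> ennreal (part Plus (step 1 0 y - k) powr (p - 1) / norm (x - y) powr ?N)"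
        using assms by (auto simp: indicator_def step_def intro!: ennreal_leI)
    qed
    finally show ?thesis .
  qed
  have "k * (1 - k) powr (p - 1) * 2 powr - ?N * r powr (1 - s * p) = k * (?c * r) * r"
  proof -
    have "r powr (1 - s * p) = r powr - ?N * r * r"
      using assms powr_add[of r "- ?N" 2] by (simp add: power2_eq_square)
    then show ?thesis
      using assms by (simp add: powr_mult mult_ac)
  qed
  then have "ennreal (k * (1 - k) powr (p - 1) * 2 powr - ?N * r powr (1 - s * p))
      = (\<integral>\<^sup>+x. ennreal k * ennreal (?c * r) * indicator {-r<..0} x \<partial>lborel)"
    using assms by (subst nn_integral_cmult_indicator) (auto simp: ennreal_mult[symmetric])
  also have "\<dots> \<le> (\<integral>\<^sup>+x\<in>ball 0 r. ennreal (part Minus (step 1 0 x - k))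
         * (\<integral>\<^sup>+y. ennreal (part Plus (step 1 0 y - k) powr (p - 1) / norm (x - y) powr ?N) \<partial>lborel) \<partial>lborel)"
    using inner assms
    by (intro nn_integral_mono) (auto simp: indicator_def step_def dist_real_def intro!: mult_left_mono)
  finally show ?thesis
    by (simp add: nn_integral_completion)
qed

text \<open>
  The level \<open>k\<close> enters through \<open>k powr p\<close> in the tail term as well, as \<open>k\<close> from the \<open>L\<^sup>1\<close> norm times
  \<open>k powr (p - 1)\<close> from the tail. The level-set term has no power of \<open>k\<close> but the higher power of \<open>r\<close>,
  which is why \<open>r\<close> has to tend to \<open>0\<close> before \<open>k\<close> does.
\<close>

lemma DG_rhs_step_at_0:
  fixes s p k r :: real
  assumes "0 < s * p" "1 < p" "0 < r" "0 < k" "k < 1" "0 \<le> d" "0 \<le> H"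
  shows "DG_rhs Minus s p d H lam (step 1 0) 0 r (2 * r) k
    = ennreal (H * (2 * d powr p * (2 * r) powr lam * r
        + (2 * 2 powr ((1 - s) * p) + 2 * 2 powr (1 + s * p) / (s * p)) * k powr p * r powr (1 - s * p)))"
proof -
  let ?N = "1 + s * p"
  have w: "(\<lambda>x. part Minus (step 1 0 x - k)) = step 0 k"
    using assms by (auto simp: step_def)
  have Lq: "(\<integral>\<^sup>+x\<in>ball 0 (2 * r). ennreal (\<bar>step 0 k x\<bar> powr q) \<partial>lebesgue) = ennreal (k powr q * (2 * r))" for q
  proof -
    have "(\<integral>\<^sup>+x\<in>ball 0 (2 * r). ennreal (\<bar>step 0 k x\<bar> powr q) \<partial>lebesgue)
        = (\<integral>\<^sup>+x. ennreal (k powr q) * indicator {- (2 * r)<..0} x \<partial>lborel)"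
      unfolding nn_integral_completion using assms
      by (intro nn_integral_cong) (auto simp: indicator_def step_def dist_real_def)
    also have "\<dots> = ennreal (k powr q * (2 * r))"
      using assms by (subst nn_integral_cmult_indicator) (auto simp: ennreal_mult)
    finally show ?thesis .
  qed
  have "level_set Minus (step 1 0) k 0 (2 * r) = {- (2 * r)<..0}"
    using assms by (auto simp: step_def dist_real_def split: if_splits)
  then have level: "emeasure lebesgue (level_set Minus (step 1 0) k 0 (2 * r)) = ennreal (2 * r)"
    using assms by simp
  have L1: "Lnorm 1 (ball 0 (2 * r)) (step 0 k) = ennreal (k * (2 * r))"
    unfolding Lnorm_def Lq using assms by (simp add: epowr_def)
  have Lp: "epowr (Lnorm p (ball 0 (2 * r)) (step 0 k)) p = ennreal (k powr p * (2 * r))"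
    using assms by (simp add: Lnorm_def Lq epowr_epowr_inverse)
  have "(\<integral>\<^sup>+x\<in>- ball 0 r. ennreal (\<bar>step 0 k x\<bar> powr (p - 1) / norm (x - 0) powr ?N) \<partial>lborel)
      = (\<integral>\<^sup>+x. ennreal (k powr (p - 1)) * (ennreal (1 / \<bar>0 - x\<bar> powr ?N) * indicator {..0 - r} x) \<partial>lborel)"
    using assms by (intro nn_integral_cong)
      (auto simp: indicator_def step_def dist_real_def ennreal_mult[symmetric])
  also have "\<dots> = ennreal (k powr (p - 1)) * ennreal (r powr - (s * p) / (s * p))"
    using assms by (subst nn_integral_cmult) (simp_all only: nn_integral_halfline_kernel, simp_all)
  finally have tail: "epowr (tail s p (step 0 k) 0 r) (p - 1) = ennreal (k powr (p - 1) * (r powr - (s * p) / (s * p)))"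
    using assms by (simp add: tail_def epowr_epowr_inverse nn_integral_completion ennreal_mult[symmetric])
  have Lp_weight: "(2 * r) powr ((1 - s) * p) / r powr p * (k powr p * (2 * r))
      = 2 * 2 powr ((1 - s) * p) * k powr p * r powr (1 - s * p)"
  proof -
    have "(2 * r) powr ((1 - s) * p) / r powr p * r = 2 powr ((1 - s) * p) * (r powr ((1 - s) * p - p) * r powr 1)"
      using assms by (simp add: powr_mult powr_diff)
    also have "r powr ((1 - s) * p - p) * r powr 1 = r powr (1 - s * p)"
      by (simp only: powr_add[symmetric]) (simp add: algebra_simps)
    finally have eq: "(2 * r) powr ((1 - s) * p) / r powr p * r = 2 powr ((1 - s) * p) * r powr (1 - s * p)" .
    have "(2 * r) powr ((1 - s) * p) / r powr p * (k powr p * (2 * r))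
        = 2 * k powr p * ((2 * r) powr ((1 - s) * p) / r powr p * r)"
      by (simp only: mult_ac)
    then show ?thesis
      unfolding eq by (simp only: mult_ac)
  qed
  have tail_weight: "(2 * r) powr ?N / r powr ?N * (k * (2 * r)) * (k powr (p - 1) * (r powr - (s * p) / (s * p)))
      = 2 * 2 powr ?N / (s * p) * k powr p * r powr (1 - s * p)"
  proof -
    have powers: "k * k powr (p - 1) = k powr p" "r * r powr - (s * p) = r powr (1 - s * p)"
      using assms powr_mult_base[of k "p - 1"] powr_mult_base[of r "- (s * p)"] by simp_all
    have "(2 * r) powr ?N / r powr ?N = 2 powr ?N"
      using assms by (simp add: powr_mult)
    then have "(2 * r) powr ?N / r powr ?N * (k * (2 * r)) * (k powr (p - 1) * (r powr - (s * p) / (s * p)))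
        = 2 * 2 powr ?N / (s * p) * (k * k powr (p - 1)) * (r * r powr - (s * p))"
      by simp
    then show ?thesis
      unfolding powers .
  qed
  have "DG_rhs Minus s p d H lam (step 1 0) 0 r (2 * r) k
      = ennreal H * (ennreal ((2 * r) powr lam * d powr p) * ennreal (2 * r)
        + ennreal ((2 * r) powr ((1 - s) * p) / r powr p) * ennreal (k powr p * (2 * r))
        + ennreal ((2 * r) powr ?N / r powr ?N) * ennreal (k * (2 * r))
            * ennreal (k powr (p - 1) * (r powr - (s * p) / (s * p))))"
    unfolding DG_rhs_def Let_def w level L1 Lp tail by simp
  also have "\<dots> = ennreal (H * ((2 * r) powr lam * d powr p * (2 * r)
        + (2 * r) powr ((1 - s) * p) / r powr p * (k powr p * (2 * r))
        + (2 * r) powr ?N / r powr ?N * (k * (2 * r)) * (k powr (p - 1) * (r powr - (s * p) / (s * p)))))"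
    using assms by (simp only: ennreal_mult[symmetric] ennreal_plus[symmetric]
      mult_nonneg_nonneg add_nonneg_nonneg divide_nonneg_nonneg powr_ge_zero less_imp_le
      zero_le_numeral)
  finally show ?thesis
    unfolding Lp_weight tail_weight by (simp add: algebra_simps)
qed

lemma step_not_in_strong_DG_minus:
  assumes sp: "0 < s" "1 < p" and dH: "0 \<le> d" "0 \<le> lam" "1 \<le> H"
  shows "step 1 0 \<notin> strong_DG_minus s p {-1<..<1} d H lam"
proof
  assume strong: "step 1 0 \<in> strong_DG_minus s p {-1<..<1} d H lam"
  have a: "0 < s * p" using sp by simp
  define c where "c = 2 powr - (1 + s * p)"
  define C where "C = 2 * 2 powr ((1 - s) * p) + 2 * 2 powr (1 + s * p) / (s * p)"
  have "c > 0" by (simp add: c_def)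
  have ineq: "k * (1 - k) powr (p - 1) * c \<le> H * (2 * d powr p * r powr (s * p) + C * k powr p)"
    if r: "0 < r" "r < 1 / 2" and k: "0 < k" "k < 1" for r k
  proof -
    have "ennreal (k * (1 - k) powr (p - 1) * c * r powr (1 - s * p))
        \<le> (\<integral>\<^sup>+x\<in>ball 0 r. ennreal (part Minus (step 1 0 x - k))
         * (\<integral>\<^sup>+y. ennreal (part Plus (step 1 0 y - k) powr (p - 1)
              / norm (x - y) powr (real DIM(real) + s * p)) \<partial>lebesgue) \<partial>lebesgue)"
      unfolding c_def using a sp r k by (intro mixed_term_ge) auto
    also have "\<dots> \<le> gagliardo_pow s p (ball 0 r) (\<lambda>x. part Minus (step 1 0 x - k)) + \<dots>"
      by simp
    also have "\<dots> \<le> DG_rhs Minus s p d H lam (step 1 0) 0 r (2 * r) k"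
    proof -
      have "(0::real) \<in> {-1<..<1}" "0 < r \<and> r < 2 * r \<and> 2 * r < infdist (0::real) (frontier {-1<..<1})"
        using r by (auto simp: infdist_0_frontier_interval)
      with strong show ?thesis
        unfolding strong_DG_minus_def by blast
    qed
    also have "\<dots> = ennreal (H * (2 * d powr p * (2 * r) powr lam * r + C * k powr p * r powr (1 - s * p)))"
      unfolding C_def using a sp r k dH by (intro DG_rhs_step_at_0) auto
    finally have "k * (1 - k) powr (p - 1) * c * r powr (1 - s * p)
        \<le> H * (2 * d powr p * (2 * r) powr lam * r + C * k powr p * r powr (1 - s * p))"
      using a sp r k dH by (subst (asm) ennreal_le_iff) (auto simp: C_def)
    also have "\<dots> \<le> H * (2 * d powr p * 1 * r + C * k powr p * r powr (1 - s * p))"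
      using r dH by (intro mult_left_mono add_mono mult_right_mono powr_le1) auto
    also have "\<dots> = H * (2 * d powr p * r powr (s * p) + C * k powr p) * r powr (1 - s * p)"
    proof -
      have "r = r powr (s * p) * r powr (1 - s * p)"
        using r by (simp add: powr_add[symmetric])
      then have "2 * d powr p * 1 * r = 2 * d powr p * r powr (s * p) * r powr (1 - s * p)"
        by simp
      then show ?thesis
        by (simp only: distrib_right mult.assoc)
    qed
    finally show ?thesis
      using r by simp
  qed
  have ineq0: "(1 - k) powr (p - 1) * c \<le> H * C * k powr (p - 1)" if k: "0 < k" "k < 1" for k
  proof -
    have "((\<lambda>r. H * (2 * d powr p * r powr (s * p) + C * k powr p))
        \<longlongrightarrow> H * (2 * d powr p * 0 powr (s * p) + C * k powr p)) (at_right 0)"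
      using a by (intro tendsto_intros tendsto_powr') (auto simp: eventually_at_right_less eventually_at_filter)
    moreover have "\<forall>\<^sub>F r in at_right 0. k * (1 - k) powr (p - 1) * c \<le> H * (2 * d powr p * r powr (s * p) + C * k powr p)"
      by (rule eventually_mono[OF eventually_at_right_real[of 0 "1 / 2"]]) (use ineq k in auto)
    ultimately have "k * (1 - k) powr (p - 1) * c \<le> H * (2 * d powr p * 0 powr (s * p) + C * k powr p)"
      by (rule tendsto_lowerbound) simp
    also have "\<dots> = k * (H * C * k powr (p - 1))"
      using k a powr_mult_base[of k "p - 1"] by (simp add: mult_ac)
    finally show ?thesis
      using k by (simp add: mult.assoc)
  qed
  have "((\<lambda>k. H * C * k powr (p - 1)) \<longlongrightarrow> H * C * 0 powr (p - 1)) (at_right 0)"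
    using sp by (intro tendsto_intros tendsto_powr') (auto simp: eventually_at_filter)
  moreover have "((\<lambda>k. (1 - k) powr (p - 1) * c) \<longlongrightarrow> (1 - 0) powr (p - 1) * c) (at_right 0)"
    by (intro tendsto_intros) auto
  moreover have "\<forall>\<^sub>F k in at_right 0. (1 - k) powr (p - 1) * c \<le> H * C * k powr (p - 1)"
    by (rule eventually_mono[OF eventually_at_right_real[of 0 1]]) (use ineq0 in auto)
  ultimately have "(1 - 0) powr (p - 1) * c \<le> H * C * 0 powr (p - 1)"
    by (intro tendsto_le[where F = "at_right (0::real)"]) auto
  then show False
    using \<open>c > 0\<close> by simp
qed

section \<open>The characteristic function of the half-line\<close>

theorem propositionA1:
  fixes s p :: real
  assumes "0 < s" "s < 1" "1 < p" "s * p < 1"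
  shows "(\<exists>H\<ge>1. (indicator {0<..} :: real \<Rightarrow> real) \<in> weak_DG s p {-1<..<1} 0 H 0) \<and>
    (\<forall>d lam H. 0 \<le> d \<and> 0 \<le> lam \<and> 1 \<le> H \<longrightarrow>
       (indicator {0<..} :: real \<Rightarrow> real) \<notin> strong_DG_minus s p {-1<..<1} d H lam)"
proof (intro conjI allI impI)
  let ?H = "max 1 (2 / (s * p * (1 - s * p)))"
  have "(indicator {0<..} :: real \<Rightarrow> real) \<in> weak_DG s p {-1<..<1} 0 ?H 0"
    unfolding indicator_eq_step weak_DG_def using step_in_weak_DG_side[OF assms] by simp
  then show "\<exists>H\<ge>1. (indicator {0<..} :: real \<Rightarrow> real) \<in> weak_DG s p {-1<..<1} 0 H 0"
    by (intro exI[of _ ?H]) simp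
next
  fix d lam H :: real
  assume "0 \<le> d \<and> 0 \<le> lam \<and> 1 \<le> H"
  then show "(indicator {0<..} :: real \<Rightarrow> real) \<notin> strong_DG_minus s p {-1<..<1} d H lam"
    unfolding indicator_eq_step using step_not_in_strong_DG_minus assms by simp
qed

end
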